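(* Let $f:\mathbb{R}^N\to\mathbb{R}$ be twice continuously differentiable with $\|\nabla f(x)-\nabla f(y)\|\le L_f\|x-y\|$ for all $x,y\in\mathbb{R}^N$, where $L_f>0$, and let $S=\{x\in\mathbb{R}^N : \|x\|_0\le s\}$. If $x^*\in S$ is an optimal solution of $\min f(x)$ subject to $x\in S$, then for every $0<\alpha<\frac{1}{L_f}$ the point $x^*$ is an $\alpha$-stationary point of this problem, and moreover $$d^\top\nabla^2 f(x^* )d\ge0\qquad\forall d\in T^C_S(x^* ),$$ where $\nabla^2 f(x^* )$ is the Hessian matrix of $f$ at $x^*$.
   Context: $N$ and $s$ are positive integers with $s<N$; $\|x\|_0$ is the number of nonzero entries of $x\in\mathbb{R}^N$; $\|\cdot\|$ is the Euclidean norm. An optimal solution is a global minimizer. $P_S(x)=\arg\min_{y\in S}\|x-y\|$ is the (set-valued) projection onto $S$. A point $x^*\in S$ is an $\alpha$-stationary point if $x^*\in P_S(x^*-\alpha\nabla f(x^* ))$. The Clarke tangent cone $T^C_S(\overline{x})$ of $S$ at $\overline{x}\in S$ is the set of all $d\in\mathbb{R}^N$ such that for every sequence $\{x^k\}\subset S$ with $\lim_{k\to\infty}x^k=\overline{x}$ and every sequence $\{\lambda_k\}\subset\mathbb{R}_+$ with $\lim_{k\to\infty}\lambda_k=0$ there exists a sequence $\{y^k\}\subset\mathbb{R}^N$ with $\lim_{k\to\infty}y^k=d$ and $x^k+\lambda_k y^k\in S$ for $k=1,2,\dots$. *)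

theory Defs
  imports "HOL-Analysis.Analysis"
begin

definition l0_norm :: "real ^ 'n \<Rightarrow> nat"
  where "l0_norm x = card {i. x $ i \<noteq> 0}"

definition sparse_set :: "nat \<Rightarrow> (real ^ 'n) set"
  where "sparse_set s = {x. l0_norm x \<le> s}"

(* Junk value where f is not differentiable. *)
definition gradient :: "(real ^ 'n \<Rightarrow> real) \<Rightarrow> real ^ 'n \<Rightarrow> real ^ 'n"
  where "gradient f x = (\<chi> i. frechet_derivative f (at x) (axis i 1))"

lemma GDERIV_gradient:
  fixes f :: "real ^ 'n \<Rightarrow> real"
  assumes "f differentiable (at x)"
  shows "GDERIV f x :> gradient f x"
proof -
  let ?F = "frechet_derivative f (at x)"
  have lin: "linear ?F"
    using assms by (rule linear_frechet_derivative)
  have "?F h = inner h (gradient f x)" for h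
  proof -
    have "?F h = ?F (\<Sum>i\<in>UNIV. h $ i *\<^sub>R axis i 1)"
      using basis_expansion[of h] by (simp add: scalar_mult_eq_scaleR)
    also have "\<dots> = (\<Sum>i\<in>UNIV. h $ i * ?F (axis i 1))"
      by (simp add: linear_sum[OF lin] linear_cmul[OF lin])
    also have "\<dots> = inner h (gradient f x)"
      by (simp add: gradient_def inner_vec_def)
    finally show ?thesis .
  qed
  then have "?F = (\<lambda>h. inner h (gradient f x))"
    by (rule ext)
  then show ?thesis
    using assms unfolding gderiv_def frechet_derivative_works by simp
qed

(* The (i, j) entry is the j-th partial derivative of the i-th partial derivative of f. *)
definition hessian :: "(real ^ 'n \<Rightarrow> real) \<Rightarrow> real ^ 'n \<Rightarrow> real ^ 'n ^ 'n"
  where "hessian f x = jacobian (gradient f) (at x)"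

definition twice_continuously_differentiable :: "(real ^ 'n \<Rightarrow> real) \<Rightarrow> bool"
  where "twice_continuously_differentiable f \<longleftrightarrow>
    (\<forall>x. f differentiable (at x)) \<and>
    (\<forall>x. gradient f differentiable (at x)) \<and>
    continuous_on UNIV (hessian f)"

definition optimal_solution :: "('a \<Rightarrow> real) \<Rightarrow> 'a set \<Rightarrow> 'a \<Rightarrow> bool"
  where "optimal_solution f S x \<longleftrightarrow> is_arg_min f (\<lambda>y. y \<in> S) x"

(* Set-valued, unlike closest_point: S need not be convex. *)
definition proj :: "(real ^ 'n) set \<Rightarrow> real ^ 'n \<Rightarrow> (real ^ 'n) set"
  where "proj S x = {y. is_arg_min (\<lambda>z. norm (x - z)) (\<lambda>z. z \<in> S) y}"

definition alpha_stationary ::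
    "real \<Rightarrow> (real ^ 'n \<Rightarrow> real) \<Rightarrow> (real ^ 'n) set \<Rightarrow> real ^ 'n \<Rightarrow> bool"
  where "alpha_stationary \<alpha> f S x \<longleftrightarrow> x \<in> S \<and> x \<in> proj S (x - \<alpha> *\<^sub>R gradient f x)"

definition clarke_tangent_cone :: "(real ^ 'n) set \<Rightarrow> real ^ 'n \<Rightarrow> (real ^ 'n) set"
  where "clarke_tangent_cone S x = {d.
    \<forall>(X :: nat \<Rightarrow> real ^ 'n) (l :: nat \<Rightarrow> real).
      (\<forall>k. X k \<in> S) \<longrightarrow> X \<longlonglongrightarrow> x \<longrightarrow> (\<forall>k. 0 \<le> l k) \<longrightarrow> l \<longlonglongrightarrow> 0 \<longrightarrow>
      (\<exists>Y. Y \<longlonglongrightarrow> d \<and> (\<forall>k. X k + l k *\<^sub>R Y k \<in> S))}"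

end

theory Submission
  imports Defs
begin

text \<open>Stationarity: by the descent lemma, minimality of \<open>x\<close> forces
  \<open>\<nabla>f(x) \<bullet> (y - x) + L/2 \<parallel>y - x\<parallel>\<^sup>2 \<ge> 0\<close> on \<open>S\<close>, and completing the square with
  \<open>L < 1/\<alpha>\<close> turns this into \<open>x\<close> being a nearest point of \<open>S\<close> to \<open>x - \<alpha> \<nabla>f(x)\<close>.
  Second order: since \<open>s < N\<close>, filling up the support of \<open>x\<close> to exactly \<open>s\<close> indices while
  avoiding a given index \<open>i\<close> outside it shows that every Clarke tangent vector \<open>d\<close> is supported
  where \<open>x\<close> is. Hence the whole line \<open>x + t d\<close> lies in \<open>S\<close>, and the claim is the
  one-dimensional second-order condition at \<open>t = 0\<close>.\<close>

lemma DERIV_along_line: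
  fixes f :: "real ^ 'n \<Rightarrow> real"
  assumes "f differentiable (at (x + t *\<^sub>R v))"
  shows "((\<lambda>t. f (x + t *\<^sub>R v)) has_real_derivative (v \<bullet> gradient f (x + t *\<^sub>R v))) (at t)"
proof -
  have f: "(f has_derivative (\<lambda>h. h \<bullet> gradient f (x + t *\<^sub>R v))) (at (x + t *\<^sub>R v))"
    using GDERIV_gradient[OF assms] by (simp add: gderiv_def)
  have "((\<lambda>t. x + t *\<^sub>R v) has_derivative (\<lambda>h. h *\<^sub>R v)) (at t)"
    by (auto intro!: derivative_eq_intros)
  from has_derivative_compose[OF this f] show ?thesis
    by (simp add: has_field_derivative_def mult_commute_abs)
qed

text \<open>The gap between \<open>f\<close> and its quadratic model along the segment is monotone:
  by Cauchy-Schwarz and the Lipschitz bound its derivative is nonpositive for t \<ge> 0.\<close>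

lemma descent_lemma:
  fixes f :: "real ^ 'n \<Rightarrow> real"
  assumes diff: "\<And>x. f differentiable (at x)"
    and lip: "\<And>x y. norm (gradient f x - gradient f y) \<le> L * norm (x - y)"
  shows "f (x + v) \<le> f x + gradient f x \<bullet> v + L / 2 * (norm v)\<^sup>2"
proof -
  \<comment> \<open>\<open>\<psi> 0\<close> is \<open>f x\<close>, so the claim is exactly
    \<open>\<psi> 1 \<le> \<psi> 0\<close>.\<close>
  define \<psi> where "\<psi> t = f (x + t *\<^sub>R v) - t * (v \<bullet> gradient f x) - L / 2 * t\<^sup>2 * (norm v)\<^sup>2" for t
  have der: "(\<psi> has_real_derivative
      (v \<bullet> gradient f (x + t *\<^sub>R v) - v \<bullet> gradient f x - L * t * (norm v)\<^sup>2)) (at t)" for t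
    unfolding \<psi>_def
    by (rule derivative_eq_intros DERIV_along_line diff refl | simp)+
  have nonpos: "v \<bullet> gradient f (x + t *\<^sub>R v) - v \<bullet> gradient f x - L * t * (norm v)\<^sup>2 \<le> 0"
    if "0 \<le> t" for t
  proof -
    have "v \<bullet> (gradient f (x + t *\<^sub>R v) - gradient f x)
        \<le> norm v * norm (gradient f (x + t *\<^sub>R v) - gradient f x)"
      by (rule norm_cauchy_schwarz)
    also have "\<dots> \<le> norm v * (L * norm (t *\<^sub>R v))"
      using lip[of "x + t *\<^sub>R v" x] by (intro mult_left_mono) auto
    also have "\<dots> = L * t * (norm v)\<^sup>2"
      using that by (simp add: power2_eq_square)
    finally show ?thesis
      by (simp add: inner_diff_right)
  qed
  have "\<psi> 1 \<le> \<psi> 0"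
    by (rule DERIV_nonpos_imp_nonincreasing[of 0 1 \<psi>]) (use der nonpos in \<open>auto intro!: exI\<close>)
  then show ?thesis
    by (simp add: \<psi>_def inner_commute)
qed

lemma optimal_imp_alpha_stationary:
  fixes f :: "real ^ 'n \<Rightarrow> real"
  assumes diff: "\<And>x. f differentiable (at x)"
    and lip: "\<And>x y. norm (gradient f x - gradient f y) \<le> L * norm (x - y)"
    and "0 < L"
    and opt: "optimal_solution f S x"
    and \<alpha>: "0 < \<alpha>" "\<alpha> < 1 / L"
  shows "alpha_stationary \<alpha> f S x"
proof -
  let ?g = "gradient f x"
  have x: "x \<in> S" and min: "\<And>y. y \<in> S \<Longrightarrow> f x \<le> f y"
    using opt by (auto simp: optimal_solution_def is_arg_min_linorder)
  have "norm (x - \<alpha> *\<^sub>R ?g - x) \<le> norm (x - \<alpha> *\<^sub>R ?g - y)" if "y \<in> S" for y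
  proof -
    define v where "v = y - x"
    have "f x \<le> f (x + v)"
      using min[OF that] by (simp add: v_def)
    then have "0 \<le> ?g \<bullet> v + L / 2 * (norm v)\<^sup>2"
      using descent_lemma[OF diff lip, of x v] by linarith
    \<comment> \<open>The factor 2\<alpha> turns the linear term into the cross term of the square
      of \<open>norm (\<alpha> *\<^sub>R ?g + v)\<close>.\<close>
    then have "0 \<le> 2 * \<alpha> * (?g \<bullet> v + L / 2 * (norm v)\<^sup>2)"
      using \<alpha> by simp
    also have "\<dots> = 2 * \<alpha> * (?g \<bullet> v) + (\<alpha> * L) * (norm v)\<^sup>2"
      by (simp add: algebra_simps)
    also have "\<dots> \<le> 2 * \<alpha> * (?g \<bullet> v) + 1 * (norm v)\<^sup>2"
      using less_imp_le[OF \<alpha>(2)] \<open>0 < L\<close>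
      by (intro add_left_mono mult_right_mono) (simp_all add: pos_le_divide_eq)
    also have "\<dots> = (norm (\<alpha> *\<^sub>R ?g + v))\<^sup>2 - (norm (\<alpha> *\<^sub>R ?g))\<^sup>2"
      using dot_norm[of "\<alpha> *\<^sub>R ?g" v] by (simp only: inner_scaleR_left) argo
    finally have "(norm (\<alpha> *\<^sub>R ?g))\<^sup>2 \<le> (norm (\<alpha> *\<^sub>R ?g + v))\<^sup>2"
      by (simp only: diff_ge_0_iff_ge)
    then have "norm (\<alpha> *\<^sub>R ?g) \<le> norm (\<alpha> *\<^sub>R ?g + v)"
      using norm_ge_zero by (rule power2_le_imp_le)
    moreover have "x - \<alpha> *\<^sub>R ?g - y = - (\<alpha> *\<^sub>R ?g + v)"
      by (simp add: v_def)
    moreover have "x - \<alpha> *\<^sub>R ?g - x = - (\<alpha> *\<^sub>R ?g)"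
      by simp
    ultimately show ?thesis
      by (simp only: norm_minus_cancel)
  qed
  then show ?thesis
    using x by (simp add: alpha_stationary_def proj_def is_arg_min_linorder)
qed

text \<open>The Clarke condition must hold along every sequence in the set. If \<open>d $ i\<close>
  were nonzero, approach \<open>x\<close> through points with s nonzero entries, none at
  \<open>i\<close>: a step towards \<open>d\<close> switches on \<open>i\<close> and keeps the
  others, giving s + 1 nonzero entries.\<close>

lemma clarke_tangent_cone_sparse_support:
  fixes x d :: "real ^ 'n"
  assumes s: "s < CARD('n)" and x: "x \<in> sparse_set s"
    and d: "d \<in> clarke_tangent_cone (sparse_set s) x"
    and "x $ i = 0"
  shows "d $ i = 0"
proof (rule ccontr)
  assume di: "d $ i \<noteq> 0"
  define G where "G = {j. x $ j \<noteq> 0}"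
  have iG: "i \<notin> G" and cG: "card G \<le> s"
    using assms by (auto simp: G_def sparse_set_def l0_norm_def)
  have "card (- insert i G) = CARD('n) - Suc (card G)"
    using iG by (simp add: card_Diff_subset Compl_eq_Diff_UNIV)
  \<comment> \<open>Here s < N enters: even with \<open>i\<close> excluded, enough indices remain
    outside \<open>G\<close> to fill the support up to s.\<close>
  then have "s - card G \<le> card (- insert i G)"
    using s cG by linarith
  then obtain J where J: "J \<subseteq> - insert i G" "card J = s - card G"
    by (meson obtain_subset_with_card_n)
  define u :: "real ^ 'n" where "u = (\<chi> j. if j \<in> J then 1 else 0)"
  define r where "r k = inverse (real (Suc k))" for k
  define X where "X k = x + r k *\<^sub>R u" for k
  have r0: "r \<longlonglongrightarrow> 0"
    unfolding r_def by (rule LIMSEQ_inverse_real_of_nat)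
  have rpos: "r k > 0" for k
    by (simp add: r_def)
  have card: "card (G \<union> J) = s"
    using J cG by (subst card_Un_disjoint) auto
  have "X k \<in> sparse_set s" for k
  proof -
    have "{j. X k $ j \<noteq> 0} \<subseteq> G \<union> J"
      by (auto simp: X_def u_def G_def)
    then show ?thesis
      using card_mono[of "G \<union> J"] card by (fastforce simp: sparse_set_def l0_norm_def)
  qed
  moreover have X: "X \<longlonglongrightarrow> x"
    unfolding X_def using tendsto_add[OF tendsto_const tendsto_scaleR[OF r0 tendsto_const]]
    by force
  \<comment> \<open>The step length is the square of the perturbation scale \<open>r k\<close>, so
    on \<open>J\<close> the step is of lower order and cannot cancel the entry
    \<open>r k\<close>.\<close>
  moreover have l: "(\<lambda>k. (r k)\<^sup>2) \<longlonglongrightarrow> 0"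
    using tendsto_power[OF r0, of 2] by simp
  ultimately obtain Y where Y: "Y \<longlonglongrightarrow> d" and S: "\<And>k. X k + (r k)\<^sup>2 *\<^sub>R Y k \<in> sparse_set s"
    using d[unfolded clarke_tangent_cone_def mem_Collect_eq, rule_format, of X "\<lambda>k. (r k)\<^sup>2"]
    by auto
  define Z where "Z k = X k + (r k)\<^sup>2 *\<^sub>R Y k" for k
  have Z: "Z \<longlonglongrightarrow> x"
    unfolding Z_def using tendsto_add[OF X tendsto_scaleR[OF l Y]] by simp
  have "\<forall>\<^sub>F k in sequentially. Z k $ j \<noteq> 0" if j: "j \<in> insert i (G \<union> J)" for j
  proof -
    consider "j = i" | "j \<in> G" | "j \<in> J"
      using j by blast
    then show ?thesis
    proof cases
      case 1
      have "\<forall>\<^sub>F k in sequentially. Y k $ i \<noteq> 0"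
        by (rule tendsto_imp_eventually_ne[OF tendsto_vec_nth[OF Y] di])
      \<comment> \<open>Neither \<open>x\<close> nor \<open>u\<close> contributes at
        \<open>i\<close>; only the step towards \<open>d\<close> is left.\<close>
      moreover have "Z k $ i = (r k)\<^sup>2 * Y k $ i" for k
        using J \<open>x $ i = 0\<close> by (auto simp: Z_def X_def u_def)
      ultimately show ?thesis
        using rpos 1 by (auto simp: less_imp_neq[symmetric])
    next
      case 2
      then show ?thesis
        by (intro tendsto_imp_eventually_ne[OF tendsto_vec_nth[OF Z]]) (simp add: G_def)
    next
      case 3
      have "(\<lambda>k. 1 + r k * Y k $ j) \<longlonglongrightarrow> 1"
        using tendsto_add[OF tendsto_const tendsto_mult[OF r0 tendsto_vec_nth[OF Y]]] by force
      then have "\<forall>\<^sub>F k in sequentially. 1 + r k * Y k $ j \<noteq> 0"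
        by (rule tendsto_imp_eventually_ne) simp
      \<comment> \<open>On \<open>J\<close> the vector \<open>x\<close> vanishes, and the second
        factor tends to 1.\<close>
      moreover have "Z k $ j = r k * (1 + r k * Y k $ j)" for k
        using 3 J by (auto simp: Z_def X_def u_def G_def power2_eq_square algebra_simps)
      ultimately show ?thesis
        using rpos by (auto simp: less_imp_neq[symmetric])
    qed
  qed
  then have "\<forall>\<^sub>F k in sequentially. \<forall>j\<in>insert i (G \<union> J). Z k $ j \<noteq> 0"
    by (intro eventually_ball_finite) auto
  then obtain k where "\<forall>j\<in>insert i (G \<union> J). Z k $ j \<noteq> 0"
    using eventually_happens' sequentially_bot by blast
  then have "card (insert i (G \<union> J)) \<le> l0_norm (Z k)"
    unfolding l0_norm_def by (intro card_mono) auto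
  moreover have "card (insert i (G \<union> J)) = Suc s"
    using card iG J by (subst card_insert_disjoint) auto
  moreover have "l0_norm (Z k) \<le> s"
    using S by (simp add: Z_def sparse_set_def)
  ultimately show False
    by simp
qed

text \<open>The support never grows along the line. Both signs of \<open>t\<close> are allowed, so t
  = 0 becomes an unconstrained minimum and the first-order term vanishes there.\<close>

lemma line_in_sparse_set:
  fixes x d :: "real ^ 'n"
  assumes "x \<in> sparse_set s" and "\<And>i. x $ i = 0 \<Longrightarrow> d $ i = 0"
  shows "x + t *\<^sub>R d \<in> sparse_set s"
proof -
  have "{i. (x + t *\<^sub>R d) $ i \<noteq> 0} \<subseteq> {i. x $ i \<noteq> 0}"
    using assms(2) by auto
  from card_mono[OF _ this] show ?thesis
    using assms(1) by (simp add: sparse_set_def l0_norm_def)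
qed

text \<open>If \<open>c\<close> were negative, \<open>\<phi>'\<close> would drop below
  \<open>\<phi>' a\<close>, which is 0, just to the right of \<open>a\<close>, and the mean value
  theorem would give a value below the minimum.\<close>

lemma second_derivative_nonneg_at_min:
  fixes \<phi> :: "real \<Rightarrow> real"
  assumes der: "\<And>t. (\<phi> has_real_derivative \<phi>' t) (at t)"
    and der2: "(\<phi>' has_real_derivative c) (at a)"
    and min: "\<And>t. \<phi> a \<le> \<phi> t"
  shows "0 \<le> c"
proof (rule ccontr)
  assume "\<not> 0 \<le> c"
  then obtain e where e: "e > 0" "\<And>h. 0 < h \<Longrightarrow> h < e \<Longrightarrow> \<phi>' (a + h) < \<phi>' a"
    using DERIV_neg_dec_right[OF der2] by auto
  have "\<phi>' a = 0"
    \<comment> \<open>The minimum is global, so the radius 1 is arbitrary.\<close>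
    by (rule DERIV_local_min[OF der, of 1]) (use min in auto)
  then have neg: "\<phi>' t < 0" if "a < t" "t < a + e" for t
    using e(2)[of "t - a"] that by simp
  obtain z where "a < z" "z < a + e / 2" "\<phi> (a + e / 2) - \<phi> a = (a + e / 2 - a) * \<phi>' z"
    using MVT2[of a "a + e / 2" \<phi> \<phi>'] der e(1) by auto
  moreover have "(a + e / 2 - a) * \<phi>' z < 0"
    using neg[of z] calculation(1,2) e(1) by (simp add: mult_pos_neg)
  ultimately show False
    using min[of "a + e / 2"] by linarith
qed

lemma hessian_nonneg_at_line_min:
  fixes f :: "real ^ 'n \<Rightarrow> real"
  assumes diff: "\<And>x. f differentiable (at x)"
    and diff2: "gradient f differentiable (at x)"
    and min: "\<And>t. f x \<le> f (x + t *\<^sub>R d)"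
  shows "0 \<le> d \<bullet> (hessian f x *v d)"
proof (rule second_derivative_nonneg_at_min)
  show "((\<lambda>t. f (x + t *\<^sub>R d)) has_real_derivative (d \<bullet> gradient f (x + t *\<^sub>R d))) (at t)" for t
    by (rule DERIV_along_line[OF diff])
  \<comment> \<open>The base point is written as the line at t = 0, to match the chain rule
    below.\<close>
  have g: "(gradient f has_derivative (\<lambda>h. hessian f x *v h)) (at (x + 0 *\<^sub>R d))"
    using diff2 by (simp add: hessian_def flip: jacobian_works)
  have "((\<lambda>t. x + t *\<^sub>R d) has_derivative (\<lambda>h. h *\<^sub>R d)) (at 0)"
    by (auto intro!: derivative_eq_intros)
  from has_derivative_inner_right[OF has_derivative_compose[OF this g], of d]
  show "((\<lambda>t. d \<bullet> gradient f (x + t *\<^sub>R d)) has_real_derivative (d \<bullet> (hessian f x *v d))) (at 0)"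
    by (simp add: has_field_derivative_def matrix_vector_mult_scaleR mult_commute_abs)
qed (use min in simp)

theorem theorem2p5:
  fixes f :: "real ^ 'n \<Rightarrow> real" and L\<^sub>f :: real and s :: nat and x\<^sub>0 :: "real ^ 'n"
  assumes "0 < s" and "s < CARD('n)"
    and "twice_continuously_differentiable f"
    and "L\<^sub>f > 0"
    and "\<And>x y. norm (gradient f x - gradient f y) \<le> L\<^sub>f * norm (x - y)"
    and "x\<^sub>0 \<in> sparse_set s"
    and "optimal_solution f (sparse_set s) x\<^sub>0"
  shows "(\<forall>\<alpha>. 0 < \<alpha> \<and> \<alpha> < 1 / L\<^sub>f \<longrightarrow> alpha_stationary \<alpha> f (sparse_set s) x\<^sub>0) \<and>
         (\<forall>d \<in> clarke_tangent_cone (sparse_set s) x\<^sub>0. d \<bullet> (hessian f x\<^sub>0 *v d) \<ge> 0)"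
proof (intro conjI allI impI ballI)
  have diff: "f differentiable (at x)" and diff2: "gradient f differentiable (at x)" for x
    using assms(3) by (simp_all add: twice_continuously_differentiable_def)
  show "alpha_stationary \<alpha> f (sparse_set s) x\<^sub>0" if "0 < \<alpha> \<and> \<alpha> < 1 / L\<^sub>f" for \<alpha>
    using optimal_imp_alpha_stationary[OF diff assms(5,4,7)] that by blast
  show "d \<bullet> (hessian f x\<^sub>0 *v d) \<ge> 0" if d: "d \<in> clarke_tangent_cone (sparse_set s) x\<^sub>0" for d
  proof (rule hessian_nonneg_at_line_min[OF diff diff2])
    fix t
    have "x\<^sub>0 + t *\<^sub>R d \<in> sparse_set s"
      using assms(6) clarke_tangent_cone_sparse_support[OF assms(2,6) d]
      by (rule line_in_sparse_set)
    then show "f x\<^sub>0 \<le> f (x\<^sub>0 + t *\<^sub>R d)"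
      using assms(7) by (simp add: optimal_solution_def is_arg_min_linorder)
  qed
qed

end
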